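(* All permutations $w \in S_n$ with RS partition $(n-3,2,1)$ have steady-state time at most $n-3$.
   Context: The RS partition of a permutation $w$ is the common shape of its Robinson--Schensted insertion tableau $P(w)$ and recording tableau $Q(w)$. Box-ball system (BBS). Boxes are indexed by $\mathbb{Z}$ from left to right. A BBS configuration (with $n$ balls) is a sequence $X$ indexed by $\mathbb{Z}$ in which each of $1,\dots,n$ (the balls) appears exactly once and every other entry is $e := n+1$ (an empty box). One BBS move transforms $X$ into $\mathrm{BB}(X)$: the balls $1,2,\dots,n$, in this order, each jump once, to the nearest box to the right of the ball that is empty at that moment (the box a ball leaves becomes empty). $\mathrm{BB}^t(X)$ is the result of $t$ BBS moves. A permutation $w = w_1\cdots w_n \in S_n$ (one-line notation) is regarded as the configuration with ball $w_i$ in box $i$ for $1\le i\le n$ and all other boxes empty. An increasing run of a configuration is a maximal contiguous (occupying consecutive boxes) increasing nonempty sequence of balls. A soliton is an increasing run that is preserved by all subsequent BBS moves (it remains an increasing run in all later configurations). A configuration is in steady state if every ball is contained in a soliton. The steady-state time of $w$ is the number of BBS moves required for $w$ to reach steady state, i.e. the least $t\ge 0$ such that $\mathrm{BB}^t(w)$ is in steady state. *)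

theory Defs
  imports Main "HOL-Library.Extended_Nat" "HOL-Combinatorics.Permutations"
begin


text \<open>Row insertion returns the new row and the entry that was bumped, if any.\<close>

fun row_insert :: "nat \<Rightarrow> nat list \<Rightarrow> nat list \<times> nat option" where
  "row_insert x [] = ([x], None)"
| "row_insert x (y # ys) =
     (if x < y then (x # ys, Some y)
      else (let (r, b) = row_insert x ys in (y # r, b)))"

text \<open>The second component is the (zero-based) index of the row that gained a box.\<close>

fun tableau_insert :: "nat \<Rightarrow> nat list list \<Rightarrow> nat list list \<times> nat" where
  "tableau_insert x [] = ([[x]], 0)"
| "tableau_insert x (r # rs) =
     (case row_insert x r of
        (r', None) \<Rightarrow> (r' # rs, 0)
      | (r', Some y) \<Rightarrow> (let (T, i) = tableau_insert y rs in (r' # T, Suc i)))"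

definition append_to_row :: "nat \<Rightarrow> nat \<Rightarrow> nat list list \<Rightarrow> nat list list" where
  "append_to_row k i T = (if i < length T then T[i := T ! i @ [k]] else T @ [[k]])"

definition rs_step :: "nat \<times> nat \<Rightarrow> nat list list \<times> nat list list \<Rightarrow> nat list list \<times> nat list list" where
  "rs_step = (\<lambda>(k, x) (P, Q). let (P', i) = tableau_insert x P in (P', append_to_row k i Q))"

definition robinson_schensted :: "nat list \<Rightarrow> nat list list \<times> nat list list" where
  "robinson_schensted xs = fold rs_step (List.enumerate 1 xs) ([], [])"

definition insertion_tableau :: "nat list \<Rightarrow> nat list list" where
  "insertion_tableau xs = fst (robinson_schensted xs)"

definition recording_tableau :: "nat list \<Rightarrow> nat list list" where
  "recording_tableau xs = snd (robinson_schensted xs)"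

definition shape :: "nat list list \<Rightarrow> nat list" where
  "shape T = map length T"

definition one_line :: "nat \<Rightarrow> (nat \<Rightarrow> nat) \<Rightarrow> nat list" where
  "one_line n w = map w [1..<Suc n]"

definition rs_partition :: "nat \<Rightarrow> (nat \<Rightarrow> nat) \<Rightarrow> nat list" where
  "rs_partition n w = shape (insertion_tableau (one_line n w))"

lemma row_insert_length:
  "length (fst (row_insert x r)) = (if snd (row_insert x r) = None then Suc (length r) else length r)"
  by (induction r) (auto split: prod.splits)

lemma shape_tableau_insert:
  assumes "shape P = shape Q"
  shows "shape (fst (tableau_insert x P)) = shape (append_to_row k (snd (tableau_insert x P)) Q)"
  using assms
proof (induction P arbitrary: x Q)
  case Nil
  then show ?case by (simp add: shape_def append_to_row_def)
next
  case (Cons r P)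
  then obtain q Q' where Q: "Q = q # Q'" "length q = length r" "shape P = shape Q'"
    by (cases Q) (auto simp: shape_def)
  obtain r' o' where ri: "row_insert x r = (r', o')" by fastforce
  note len = row_insert_length[of x r, unfolded ri, simplified]
  show ?case
  proof (cases o')
    case None
    then show ?thesis using ri len Q by (simp add: shape_def append_to_row_def)
  next
    case (Some y)
    obtain T i where ti: "tableau_insert y P = (T, i)" by fastforce
    have "shape T = shape (append_to_row k i Q')" using Cons.IH[OF Q(3), of y] ti by simp
    then show ?thesis using Some ri len ti Q by (simp add: shape_def append_to_row_def split: if_splits)
  qed
qed

lemma shape_insertion_eq_shape_recording:
  "shape (insertion_tableau xs) = shape (recording_tableau xs)"
proof -
  have "shape (fst (fold rs_step kxs PQ)) = shape (snd (fold rs_step kxs PQ))"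
    if "shape (fst PQ) = shape (snd PQ)" for kxs PQ
    using that
  proof (induction kxs arbitrary: PQ)
    case (Cons kx kxs)
    have "shape (fst (rs_step kx PQ)) = shape (snd (rs_step kx PQ))"
      using shape_tableau_insert[OF Cons.prems, of "snd kx" "fst kx"]
      by (simp add: rs_step_def split_beta Let_def)
    then show ?case using Cons.IH by simp
  qed simp
  then show ?thesis
    by (simp add: insertion_tableau_def recording_tableau_def robinson_schensted_def)
qed



text \<open>A configuration with \<open>n\<close> balls is a function from boxes to entries; the entry
  \<open>n + 1\<close> is an empty box.\<close>

definition bbs_config :: "nat \<Rightarrow> (int \<Rightarrow> nat) \<Rightarrow> bool" where
  "bbs_config n X \<longleftrightarrow>
     (\<forall>b\<in>{1..n}. \<exists>!k. X k = b) \<and> (\<forall>k. X k \<notin> {1..n} \<longrightarrow> X k = n + 1)"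

definition jump :: "nat \<Rightarrow> nat \<Rightarrow> (int \<Rightarrow> nat) \<Rightarrow> (int \<Rightarrow> nat)" where
  "jump n b X =
     (let k = (THE k. X k = b);
          j = (LEAST j. k < j \<and> X j = n + 1)
      in X(k := n + 1, j := b))"

definition bb_move :: "nat \<Rightarrow> (int \<Rightarrow> nat) \<Rightarrow> (int \<Rightarrow> nat)" where
  "bb_move n X = fold (jump n) [1..<Suc n] X"

definition perm_config :: "nat \<Rightarrow> (nat \<Rightarrow> nat) \<Rightarrow> (int \<Rightarrow> nat)" where
  "perm_config n w = (\<lambda>i. if 1 \<le> i \<and> i \<le> int n then w (nat i) else n + 1)"

definition increasing_balls_on :: "nat \<Rightarrow> (int \<Rightarrow> nat) \<Rightarrow> int \<Rightarrow> int \<Rightarrow> bool" where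
  "increasing_balls_on n X a b \<longleftrightarrow>
     a \<le> b \<and> (\<forall>k\<in>{a..b}. X k \<in> {1..n}) \<and> strict_mono_on {a..b} X"

text \<open>A run is identified with its list of balls, so that it can be followed as it moves.\<close>

definition increasing_run :: "nat \<Rightarrow> (int \<Rightarrow> nat) \<Rightarrow> nat list \<Rightarrow> bool" where
  "increasing_run n X xs \<longleftrightarrow>
     (\<exists>a b. increasing_balls_on n X a b \<and>
            (\<forall>a' b'. a' \<le> a \<and> b \<le> b' \<and> increasing_balls_on n X a' b' \<longrightarrow> a' = a \<and> b' = b) \<and>
            xs = map X [a..b])"

definition soliton :: "nat \<Rightarrow> (int \<Rightarrow> nat) \<Rightarrow> nat list \<Rightarrow> bool" where
  "soliton n X xs \<longleftrightarrow> (\<forall>t. increasing_run n ((bb_move n ^^ t) X) xs)"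

definition steady_state :: "nat \<Rightarrow> (int \<Rightarrow> nat) \<Rightarrow> bool" where
  "steady_state n X \<longleftrightarrow> (\<forall>b\<in>{1..n}. \<exists>xs. soliton n X xs \<and> b \<in> set xs)"

text \<open>The value is \<open>\<infinity>\<close> if steady state is never reached.\<close>

definition steady_state_time :: "nat \<Rightarrow> (nat \<Rightarrow> nat) \<Rightarrow> enat" where
  "steady_state_time n w = (INF t\<in>{t. steady_state n ((bb_move n ^^ t) (perm_config n w))}. enat t)"


text \<open>The descriptions in \<open>jump\<close> always denote: a permutation gives a configuration with
  finitely many balls, and moves preserve this.\<close>

lemma bbs_config_perm_config:
  assumes "w permutes {1..n}"
  shows "bbs_config n (perm_config n w)"
proof -
  have "\<exists>!k. perm_config n w k = b" if b: "b \<in> {1..n}" for b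
  proof -
    have bij: "bij_betw w {1..n} {1..n}" using assms by (rule permutes_imp_bij)
    then obtain i where i: "i \<in> {1..n}" "w i = b" using b by (metis bij_betw_iff_bijections)
    have inj: "inj w" using assms by (rule permutes_inj)
    show ?thesis
    proof (rule ex1I[of _ "int i"])
      show "perm_config n w (int i) = b" using i by (simp add: perm_config_def)
      show "k = int i" if "perm_config n w k = b" for k
      proof -
        have k: "1 \<le> k" "w (nat k) = b" using that b by (auto simp: perm_config_def split: if_splits)
        then have "nat k = i" using i inj by (metis injD)
        then show ?thesis using k by simp
      qed
    qed
  qed
  moreover have "perm_config n w k = n + 1" if "perm_config n w k \<notin> {1..n}" for k
  proof (cases "1 \<le> k \<and> k \<le> int n")
    case True
    then have "w (nat k) \<in> {1..n}" using permutes_in_image[OF assms, of "nat k"] by auto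
    with that True show ?thesis by (simp add: perm_config_def)
  qed (auto simp: perm_config_def)
  ultimately show ?thesis by (simp add: bbs_config_def)
qed

lemma next_empty_exists:
  assumes "bbs_config n X"
  shows "\<exists>!j. (k < j \<and> X j = n + 1) \<and> (\<forall>i. k < i \<and> X i = n + 1 \<longrightarrow> j \<le> i)"
proof -
  let ?B = "{j. X j \<in> {1..n}}"
  have "inj_on X ?B" using assms unfolding bbs_config_def inj_on_def by (metis mem_Collect_eq)
  then have fin: "finite ?B" by (rule inj_on_finite[of X _ "{1..n}"]) auto
  have "\<not> {k<..} \<subseteq> ?B" using fin finite_subset infinite_Ioi by blast
  then obtain m where "k < m" "X m \<notin> {1..n}" by auto
  then have m: "k < m" "X m = n + 1" using assms unfolding bbs_config_def by blast+
  define d where "d = (LEAST d::nat. X (k + 1 + int d) = n + 1)"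
  have ex: "X (k + 1 + int (nat (m - k - 1))) = n + 1" using m by simp
  have d: "X (k + 1 + int d) = n + 1" unfolding d_def using ex by (rule LeastI)
  have min: "k + 1 + int d \<le> i" if "k < i" "X i = n + 1" for i
  proof -
    have "X (k + 1 + int (nat (i - k - 1))) = n + 1" using that by simp
    then have "d \<le> nat (i - k - 1)" unfolding d_def by (rule Least_le)
    then show ?thesis using that by linarith
  qed
  show ?thesis
  proof (rule ex1I[of _ "k + 1 + int d"])
    show "(k < k + 1 + int d \<and> X (k + 1 + int d) = n + 1) \<and>
        (\<forall>i. k < i \<and> X i = n + 1 \<longrightarrow> k + 1 + int d \<le> i)"
      using d min by auto
  next
    fix j assume "(k < j \<and> X j = n + 1) \<and> (\<forall>i. k < i \<and> X i = n + 1 \<longrightarrow> j \<le> i)"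
    then show "j = k + 1 + int d" using d min[of j] by force
  qed
qed

lemma bbs_config_jump:
  assumes X: "bbs_config n X" and b: "b \<in> {1..n}"
  shows "bbs_config n (jump n b X)"
proof -
  define k where "k = (THE k. X k = b)"
  define j where "j = (LEAST j. k < j \<and> X j = n + 1)"
  have k1: "\<exists>!k. X k = b" using X b by (auto simp: bbs_config_def)
  then have k: "X k = b" unfolding k_def by (rule theI')
  have j: "k < j" "X j = n + 1"
    using theI'[OF next_empty_exists[OF X, of k]] unfolding j_def Least_def by auto
  have J: "jump n b X = X(k := n + 1, j := b)" unfolding jump_def Let_def k_def j_def by simp
  have "\<exists>!m. jump n b X m = c" if c: "c \<in> {1..n}" for c
  proof (cases "c = b")
    case True
    show ?thesis using True k1 k j b unfolding J by (intro ex1I[of _ j]) (auto split: if_splits)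
  next
    case False
    obtain m where m: "X m = c" "\<And>m'. X m' = c \<Longrightarrow> m' = m"
      using X c unfolding bbs_config_def by metis
    have mk: "m \<noteq> k" "m \<noteq> j" using m(1) k j c False by auto
    show ?thesis
    proof (rule ex1I[of _ m])
      show "jump n b X m = c" using mk m(1) unfolding J by simp
      show "m' = m" if "jump n b X m' = c" for m'
        using that c False unfolding J by (intro m(2)) (simp split: if_splits)
    qed
  qed
  moreover have "jump n b X m = n + 1" if "jump n b X m \<notin> {1..n}" for m
    using that X b unfolding J bbs_config_def by (auto split: if_splits)
  ultimately show ?thesis unfolding bbs_config_def by blast
qed

lemma bbs_config_bb_move:
  assumes "bbs_config n X"
  shows "bbs_config n (bb_move n X)"
proof -
  have "bbs_config n (fold (jump n) bs X)" if "set bs \<subseteq> {1..n}" "bbs_config n X" for bs X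
    using that by (induction bs arbitrary: X) (simp_all add: bbs_config_jump)
  moreover have "set [1..<Suc n] \<subseteq> {1..n}" by auto
  ultimately show ?thesis using assms unfolding bb_move_def by blast
qed

end

theory Submission imports Defs begin

text \<open>A single move already separates the bulk of the balls from the rest. Scanning the boxes
  \<open>1, \<dots>, n\<close> from left to right, the balls in flight over box \<open>i\<close> during the first move
  are exactly the first row of the tableau of \<open>w\<^sub>1 \<cdots> w\<^sub>i\<close>: inserting \<open>w\<^sub>i\<close> frees box \<open>i\<close>, and the
  bumped entry, if there is one, is the ball that lands there. So after one move the first row of
  \<open>P(w)\<close> stands in increasing order in the boxes from \<open>n + 1\<close> on, and an entry bumped by \<open>w\<^sub>i\<close> stands in
  box \<open>i\<close> (\<open>first_move\<close>). The bumped entries, read from left to right, have the remaining rows of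
  \<open>P(w)\<close> as their tableau (\<open>tableau_eq_row_Cons\<close>). For the shape \<open>(n - 3, 2, 1)\<close> these are three
  balls in boxes \<open>\<alpha> < \<beta> < \<gamma> \<le> n\<close>, in an order that is neither increasing nor decreasing, behind a
  run of length \<open>n - 3 \<ge> 2\<close>.

  The long run moves ahead by its own length, and the three stragglers never catch up with it. At
  worst they step into its two rearmost boxes, but only after these have been vacated, because the
  first two entries of the run are small enough to jump before (\<open>trailing_bb_move\<close>; the
  comparisons come from \<open>bumped_below_row_0\<close> and \<open>ascending_bumps_below_row_1\<close>, which are column
  strictness of \<open>P(w)\<close>). The stragglers therefore form a box-ball system of their own, with three
  balls. If no two of them form an adjacent ascent, each of them moves by one box for ever
  (\<open>steady_state_descending_clusters\<close>). If the last two form an adjacent ascent, they are a soliton of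
  speed 2 running away from the first (\<open>steady_state_pair_ahead\<close>). If the first two do, they gain one
  box per move on the third, and the collision turns the state into the previous one
  (\<open>steady_state_pair_behind\<close>).

  Only the last case takes time: the steady state is reached \<open>\<gamma> - \<beta>\<close> moves after the first. Two
  entries bumped by consecutive insertions in ascending order must both be in the row beforehand,
  so that \<open>\<alpha> \<ge> 3\<close> (\<open>consecutive_ascending_bumps_late\<close>), hence \<open>\<beta> \<ge> 4\<close>, and the total is at
  most \<open>1 + (n - 4)\<close>.\<close>

section \<open>Moves in terms of ball positions\<close>

definition located :: "nat \<Rightarrow> (int \<Rightarrow> nat) \<Rightarrow> (nat \<Rightarrow> int) \<Rightarrow> bool" where
  "located n X p \<longleftrightarrow>
     (\<forall>b\<in>{1..n}. \<forall>k. X k = b \<longleftrightarrow> k = p b) \<and> (\<forall>k. X k \<notin> {1..n} \<longrightarrow> X k = n + 1)"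

text \<open>One move, described without sequential updates. When ball \<open>b\<close> jumps, the smaller balls already are at their
  new positions \<open>q\<close> and the larger ones still at their old positions \<open>p\<close>; the clauses say that
  \<open>q b\<close> is the nearest box to the right of \<open>p b\<close> that is free at that time. The ball set \<open>B\<close> is a
  parameter because part of a configuration can evolve as a box-ball system of its own.\<close>

definition leap :: "nat set \<Rightarrow> (nat \<Rightarrow> int) \<Rightarrow> (nat \<Rightarrow> int) \<Rightarrow> bool" where
  "leap B p q \<longleftrightarrow> (\<forall>b\<in>B. p b < q b \<and>
     (\<forall>c\<in>B. c < b \<longrightarrow> q c \<noteq> q b) \<and> (\<forall>c\<in>B. b < c \<longrightarrow> p c \<noteq> q b) \<and>
     (\<forall>i. p b < i \<and> i < q b \<longrightarrow> (\<exists>c\<in>B. c < b \<and> q c = i) \<or> (\<exists>c\<in>B. b < c \<and> p c = i)))"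

text \<open>The descriptions in the definition of a jump are resolved here once and for all, so that a move
  can be verified by naming the landing positions.\<close>

lemma located_jump:
  assumes X: "located n X p" and b: "b \<in> {1..n}" and j: "p b < j"
    and free: "\<And>c. c \<in> {1..n} \<Longrightarrow> p c \<noteq> j"
    and occ: "\<And>i. p b < i \<Longrightarrow> i < j \<Longrightarrow> \<exists>c\<in>{1..n}. p c = i"
  shows "located n (jump n b X) (p(b := j))"
proof -
  have at: "X i = c \<longleftrightarrow> i = p c" if "c \<in> {1..n}" for c i
    using X that unfolding located_def by blast
  have empty: "X i = n + 1" if "X i \<notin> {1..n}" for i
    using X that unfolding located_def by blast
  have k: "(THE k. X k = b) = p b"
    by (rule the_equality) (use at[OF b] in blast)+
  have Xj: "X j = n + 1"
    using at free empty by metis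
  have "(LEAST j. p b < j \<and> X j = n + 1) = j"
  proof (rule Least_equality)
    show "p b < j \<and> X j = n + 1" using j Xj by simp
    fix i assume i: "p b < i \<and> X i = n + 1"
    show "j \<le> i"
    proof (rule ccontr)
      assume "\<not> j \<le> i"
      then obtain c where c: "c \<in> {1..n}" "p c = i" using occ i by force
      then have "X i = c" using at by blast
      then show False using i c by simp
    qed
  qed
  then have J: "jump n b X = X(p b := n + 1, j := b)"
    unfolding jump_def Let_def k by simp
  have "jump n b X k = c \<longleftrightarrow> k = (p(b := j)) c" if c: "c \<in> {1..n}" for c k
  proof (cases "c = b")
    case True
    then show ?thesis using at[OF b, of k] b unfolding J by auto
  next
    case False
    then show ?thesis using at[OF c, of k] at[OF b, of "p b"] free[OF c] c unfolding J by auto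
  qed
  moreover have "jump n b X k = n + 1" if "jump n b X k \<notin> {1..n}" for k
    using b that empty unfolding J by (auto split: if_splits)
  ultimately show ?thesis unfolding located_def by blast
qed

lemma located_cong:
  assumes "located n X p" and "\<And>b. b \<in> {1..n} \<Longrightarrow> p b = q b"
  shows "located n X q"
  unfolding located_def
proof (intro conjI ballI allI)
  show "X k = b \<longleftrightarrow> k = q b" if "b \<in> {1..n}" for b k
    using assms(1) assms(2)[OF that] that unfolding located_def by metis
  show "X k \<notin> {1..n} \<longrightarrow> X k = n + 1" for k
    using assms(1) unfolding located_def by blast
qed

lemma located_bb_move:
  assumes X: "located n X p" and q: "leap {1..n} p q"
  shows "located n (bb_move n X) q"
proof -
  have "located n (fold (jump n) [1..<Suc m] X) (\<lambda>b. if b \<le> m then q b else p b)" if "m \<le> n" for m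
    using that
  proof (induction m)
    case 0
    have "located n X (\<lambda>b. if b \<le> 0 then q b else p b)" by (rule located_cong[OF X]) auto
    then show ?case by simp
  next
    case (Suc m)
    let ?p = "\<lambda>b. if b \<le> m then q b else p b"
    let ?b = "Suc m"
    have b: "?b \<in> {1..n}" using Suc.prems by simp
    note L = q[unfolded leap_def, rule_format, OF b]
    have "located n (jump n ?b (fold (jump n) [1..<Suc m] X)) (?p(?b := q ?b))"
    proof (rule located_jump)
      show "located n (fold (jump n) [1..<Suc m] X) ?p" using Suc by simp
      show "?b \<in> {1..n}" by (rule b)
      show "?p ?b < q ?b" using L by simp
      show "?p c \<noteq> q ?b" if "c \<in> {1..n}" for c
        using L that by (cases "c \<le> m"; cases "c = ?b") auto
      show "\<exists>c\<in>{1..n}. ?p c = i" if i: "?p ?b < i" "i < q ?b" for i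
      proof -
        have "p ?b < i \<and> i < q ?b" using i by simp
        with L consider c where "c \<in> {1..n}" "c < ?b" "q c = i" | c where "c \<in> {1..n}" "?b < c" "p c = i"
          by blast
        then show ?thesis
        proof cases
          case 1
          then have "?p c = i" by simp
          with 1 show ?thesis by blast
        next
          case 2
          then have "?p c = i" by simp
          with 2 show ?thesis by blast
        qed
      qed
    qed
    moreover have "?p(?b := q ?b) = (\<lambda>b. if b \<le> ?b then q b else p b)"
      by (rule ext) auto
    moreover have "fold (jump n) [1..<Suc ?b] X = jump n ?b (fold (jump n) [1..<Suc m] X)"
      by simp
    ultimately show ?case by simp
  qed
  from this[of n] have "located n (bb_move n X) (\<lambda>b. if b \<le> n then q b else p b)"
    unfolding bb_move_def by simp
  then show ?thesis by (rule located_cong) simp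
qed

lemma located_at:
  assumes "located n X p" "b \<in> {1..n}"
  shows "X (p b) = b"
  using assms unfolding located_def by blast

lemma located_iff:
  assumes "located n X p" "b \<in> {1..n}"
  shows "X k = b \<longleftrightarrow> k = p b"
  using assms unfolding located_def by blast

text \<open>A run cannot be extended if its neighbouring boxes are empty or hold a ball that breaks the
  ascent. Its list of balls does not mention positions, so the same list can be recognised again
  after the run has moved.\<close>

lemma increasing_run_if_located:
  assumes X: "located n X p" and ne: "xs \<noteq> []" and srt: "sorted_wrt (<) xs"
    and sub: "set xs \<subseteq> {1..n}"
    and pos: "\<And>k. k < length xs \<Longrightarrow> p (xs ! k) = A + int k"
    and left: "\<And>c. c \<in> {1..n} \<Longrightarrow> p c = A - 1 \<Longrightarrow> hd xs < c"
    and right: "\<And>c. c \<in> {1..n} \<Longrightarrow> p c = A + int (length xs) \<Longrightarrow> c < last xs"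
  shows "increasing_run n X xs"
proof -
  define E where "E = A + int (length xs) - 1"
  have len: "length xs \<ge> 1" using ne by (cases xs) auto
  have val: "X (A + int k) = xs ! k" if "k < length xs" for k
    using located_at[OF X, of "xs ! k"] pos[OF that] sub nth_mem[OF that] by auto
  have valE: "X i = xs ! nat (i - A)" "nat (i - A) < length xs" if "i \<in> {A..E}" for i
    using val[of "nat (i - A)"] that len by (auto simp: E_def)
  have inc: "increasing_balls_on n X A E"
    unfolding increasing_balls_on_def
  proof (intro conjI ballI)
    show "A \<le> E" using len unfolding E_def by linarith
    show "X k \<in> {1..n}" if "k \<in> {A..E}" for k
      using valE[OF that] sub nth_mem by force
    show "strict_mono_on {A..E} X"
    proof (rule strict_mono_onI)
      fix r s assume rs: "r \<in> {A..E}" "s \<in> {A..E}" "r < s"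
      have "xs ! nat (r - A) < xs ! nat (s - A)"
        using rs valE(2)[OF rs(2)] by (intro sorted_wrt_nth_less[OF srt]) auto
      then show "X r < X s" using valE rs by simp
    qed
  qed
  have max: "a' = A \<and> b' = E" if le: "a' \<le> A" "E \<le> b'" and i: "increasing_balls_on n X a' b'" for a' b'
  proof (rule ccontr)
    have AE: "A \<le> E" using len unfolding E_def by linarith
    have hd: "X A = hd xs" using val[of 0] len ne by (simp add: hd_conv_nth)
    have last: "X E = last xs" using val[of "length xs - 1"] len ne
      by (auto simp: last_conv_nth E_def of_nat_diff Suc_le_eq add_diff_eq)
    have mono: "X r < X s" if "r \<in> {a'..b'}" "s \<in> {a'..b'}" "r < s" for r s
      using i that unfolding increasing_balls_on_def strict_mono_on_def by blast
    have ball: "X r \<in> {1..n}" if "r \<in> {a'..b'}" for r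
      using i that unfolding increasing_balls_on_def by blast
    assume "\<not> (a' = A \<and> b' = E)"
    then consider "a' < A" | "E < b'" using le by linarith
    then show False
    proof cases
      case 1
      then have m: "A - 1 \<in> {a'..b'}" "A \<in> {a'..b'}" using le AE by auto
      then have "hd xs < X (A - 1)"
        using left[OF ball[OF m(1)]] located_iff[OF X ball[OF m(1)], of "A - 1"] by simp
      then show False using mono[OF m] hd by simp
    next
      case 2
      then have m: "E \<in> {a'..b'}" "E + 1 \<in> {a'..b'}" using le AE by auto
      then have "X (E + 1) < last xs"
        using right[OF ball[OF m(2)]] located_iff[OF X ball[OF m(2)], of "E + 1"] by (simp add: E_def)
      then show False using mono[OF m] last by simp
    qed
  qed
  have "map X [A..E] = xs"
    using valE by (intro nth_equalityI) (auto simp: E_def val)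
  then show ?thesis using inc max unfolding increasing_run_def by metis
qed

text \<open>Solitons quantify over all later times, so steady states are recognised by a family \<open>I\<close> of
  configurations that is closed under moves and whose members all have the same runs \<open>Rs\<close>.\<close>

lemma steady_state_if_invariant:
  assumes "I X"
    and step: "\<And>Y. I Y \<Longrightarrow> I (bb_move n Y)"
    and run: "\<And>Y xs. I Y \<Longrightarrow> xs \<in> Rs \<Longrightarrow> increasing_run n Y xs"
    and cover: "{1..n} \<subseteq> (\<Union>xs\<in>Rs. set xs)"
  shows "steady_state n X"
proof -
  have "I ((bb_move n ^^ t) X)" for t
    by (induction t) (simp_all add: assms)
  then have "soliton n X xs" if "xs \<in> Rs" for xs
    using run that unfolding soliton_def by blast
  then show ?thesis using cover unfolding steady_state_def by blast
qed

section \<open>Stragglers behind one long run\<close>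

text \<open>The setting after the first move: \<open>R\<close> will be the long run and \<open>F\<close> the set of balls behind
  it. The two assumptions that are not bookkeeping are that \<open>R\<close> has speed at least 2 and that its
  first ball jumps before every ball of \<open>F\<close>.\<close>

locale leading_run =
  fixes n :: nat and R :: "nat list" and F :: "nat set"
  assumes sorted_R: "sorted_wrt (<) R"
    and balls: "set R \<union> F = {1..n}" and disjoint: "set R \<inter> F = {}"
    and length_R: "2 \<le> length R"
    and hd_R: "\<And>x. x \<in> F \<Longrightarrow> R ! 0 < x"
begin

text \<open>Only the values of \<open>s\<close> on \<open>F\<close> matter. The run occupies the boxes from \<open>S\<close> on.\<close>

definition trailing :: "(nat \<Rightarrow> int) \<Rightarrow> int \<Rightarrow> (int \<Rightarrow> nat) \<Rightarrow> bool" where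
  "trailing s S X \<longleftrightarrow> (\<forall>x\<in>F. s x < S) \<and>
     (\<exists>p. located n X p \<and> (\<forall>k<length R. p (R ! k) = S + int k) \<and> (\<forall>x\<in>F. p x = s x))"

text \<open>The run moves as if it were alone, since it jumps into empty space ahead. Behind it, a ball of
  \<open>F\<close> can meet the run only in the boxes \<open>S\<close> and \<open>S + 1\<close>, and these have been vacated by
  the time it jumps: the first ball of the run is smaller than all of \<open>F\<close>, the second one smaller
  than a ball that gets as far as \<open>S + 1\<close>. So \<open>F\<close> evolves by itself.\<close>

lemma trailing_bb_move:
  assumes T: "trailing s S X" and L: "leap F s s'"
    and bound: "\<And>x. x \<in> F \<Longrightarrow> s' x \<le> S + 1"
    and snd_R: "\<And>x. x \<in> F \<Longrightarrow> s' x = S + 1 \<Longrightarrow> R ! 1 < x"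
  shows "trailing s' (S + int (length R)) (bb_move n X)"
proof -
  obtain p where X: "located n X p" and pR: "\<And>k. k < length R \<Longrightarrow> p (R ! k) = S + int k"
    and pF: "\<And>x. x \<in> F \<Longrightarrow> p x = s x"
    using T unfolding trailing_def by blast
  have sS: "s x < S" if "x \<in> F" for x using T that unfolding trailing_def by blast
  define q where "q = (\<lambda>x. if x \<in> F then s' x else p x + int (length R))"
  have RF: "R ! k \<notin> F" "R ! k \<in> {1..n}" if "k < length R" for k
    using nth_mem[OF that] balls disjoint by auto
  have qR: "q (R ! k) = S + int k + int (length R)" if "k < length R" for k
    using RF[OF that] pR[OF that] by (simp add: q_def)
  have qF: "q x = s' x" if "x \<in> F" for x using that by (simp add: q_def)
  have lessR: "R ! k < R ! l \<longleftrightarrow> k < l" if "k < length R" "l < length R" for k l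
    using sorted_R that by (metis sorted_wrt_nth_less less_asym linorder_neqE_nat)
  have cases: "(x \<in> F \<or> (\<exists>k<length R. x = R ! k))" if "x \<in> {1..n}" for x
    using that balls by (metis Un_iff in_set_conv_nth)
  have FB: "x \<in> {1..n}" if "x \<in> F" for x using that balls by blast
  have "leap {1..n} p q"
    unfolding leap_def
  proof (intro ballI)
    fix b assume "b \<in> {1..n}"
    then consider "b \<in> F" | k where "k < length R" "b = R ! k" using cases by blast
    then show "p b < q b \<and>
        (\<forall>c\<in>{1..n}. c < b \<longrightarrow> q c \<noteq> q b) \<and> (\<forall>c\<in>{1..n}. b < c \<longrightarrow> p c \<noteq> q b) \<and>
        (\<forall>i. p b < i \<and> i < q b \<longrightarrow>
           (\<exists>c\<in>{1..n}. c < b \<and> q c = i) \<or> (\<exists>c\<in>{1..n}. b < c \<and> p c = i))"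
    proof cases
      case 1
      note Lb = L[unfolded leap_def, rule_format, OF 1]
      have "q c \<noteq> q b" if c: "c \<in> {1..n}" "c < b" for c
        using cases[OF c(1)] Lb c(2) bound[OF 1] length_R by (auto simp: qF qR 1)
      moreover have "p c \<noteq> q b" if c: "c \<in> {1..n}" "b < c" for c
        using cases[OF c(1)]
      proof
        assume "c \<in> F" then show ?thesis using Lb c(2) by (simp add: pF qF 1)
      next
        assume "\<exists>k<length R. c = R ! k"
        then obtain k where k: "k < length R" "c = R ! k" by blast
        show ?thesis
        proof
          assume "p c = q b"
          then have e: "s' b = S + int k" using k pR qF 1 by simp
          then have "k = 0 \<or> k = 1" using bound[OF 1] by linarith
          then show False using e hd_R[OF 1] snd_R[OF 1] k c by auto
        qed
      qed
      moreover have "(\<exists>c\<in>{1..n}. c < b \<and> q c = i) \<or> (\<exists>c\<in>{1..n}. b < c \<and> p c = i)"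
        if "p b < i \<and> i < q b" for i
      proof -
        from Lb that 1 have "(\<exists>c\<in>F. c < b \<and> s' c = i) \<or> (\<exists>c\<in>F. b < c \<and> s c = i)"
          by (simp add: pF qF)
        then show ?thesis using FB pF qF by metis
      qed
      ultimately show ?thesis using Lb 1 by (simp add: pF qF)
    next
      case 2
      have "q c \<noteq> q b" if c: "c \<in> {1..n}" "c < b" for c
        using cases[OF c(1)]
      proof
        assume "c \<in> F"
        then show ?thesis using bound[of c] length_R 2 by (simp add: qF qR)
      next
        assume "\<exists>k<length R. c = R ! k"
        then show ?thesis using 2 c by (auto simp: qR)
      qed
      moreover have "p c \<noteq> q b" if c: "c \<in> {1..n}" "b < c" for c
        using cases[OF c(1)] sS[of c] 2 by (auto simp: pF pR qR)
      moreover have "(\<exists>c\<in>{1..n}. c < b \<and> q c = i) \<or> (\<exists>c\<in>{1..n}. b < c \<and> p c = i)"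
        if i: "p b < i \<and> i < q b" for i
      proof (cases "i < S + int (length R)")
        case True
        \<comment> \<open>the box was held by a later, hence larger, ball of the run, which has not moved yet\<close>
        define l where "l = nat (i - S)"
        have l: "l < length R" "k < l" "i = S + int l" using i True 2 by (auto simp: l_def pR qR)
        then have "p (R ! l) = i" "b < R ! l" using pR 2 lessR by auto
        then show ?thesis using RF l by blast
      next
        case False
        \<comment> \<open>the box has just been filled by an earlier, hence smaller, ball of the run\<close>
        define l where "l = nat (i - S - int (length R))"
        have l: "l < length R" "l < k" "i = S + int l + int (length R)"
          using i False 2 by (auto simp: l_def pR qR)
        then have "q (R ! l) = i" "R ! l < b" using qR 2 lessR by auto
        then show ?thesis using RF l by blast
      qed
      ultimately show ?thesis using 2 length_R by (auto simp: pR qR)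
    qed
  qed
  then have "located n (bb_move n X) q" by (rule located_bb_move[OF X])
  moreover have "s' x < S + int (length R)" if "x \<in> F" for x
    using bound[OF that] length_R by linarith
  ultimately show ?thesis unfolding trailing_def using qR qF by force
qed

text \<open>The only ball of the long run that can be adjacent to a straggler is its first one, and this
  ball is smaller than the straggler, so it does not prolong an ascent.\<close>

lemma increasing_run_trailing:
  assumes T: "trailing s S X" and ne: "xs \<noteq> []" and srt: "sorted_wrt (<) xs"
    and sub: "set xs \<subseteq> F"
    and pos: "\<And>k. k < length xs \<Longrightarrow> s (xs ! k) = A + int k"
    and left: "\<And>c. c \<in> F \<Longrightarrow> s c = A - 1 \<Longrightarrow> hd xs < c"
    and right: "\<And>c. c \<in> F \<Longrightarrow> s c = A + int (length xs) \<Longrightarrow> c < last xs"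
  shows "increasing_run n X xs"
proof -
  obtain p where X: "located n X p" and pR: "\<And>k. k < length R \<Longrightarrow> p (R ! k) = S + int k"
    and pF: "\<And>x. x \<in> F \<Longrightarrow> p x = s x"
    using T unfolding trailing_def by blast
  have sS: "s x < S" if "x \<in> F" for x using T that unfolding trailing_def by blast
  have cases: "(x \<in> F \<or> (\<exists>k<length R. x = R ! k))" if "x \<in> {1..n}" for x
    using that balls by (metis Un_iff in_set_conv_nth)
  have len: "length xs \<ge> 1" using ne by (cases xs) auto
  have lastF: "last xs \<in> F" "last xs = xs ! (length xs - 1)"
    using ne sub last_in_set by (auto simp: last_conv_nth)
  then have lastpos: "A + int (length xs) \<le> S"
    using pos[of "length xs - 1"] sS[OF lastF(1)] len by (simp add: of_nat_diff)
  show ?thesis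
  proof (rule increasing_run_if_located[OF X ne srt])
    show "set xs \<subseteq> {1..n}" using sub balls by blast
    show "p (xs ! k) = A + int k" if "k < length xs" for k
      using pos[OF that] sub that pF nth_mem by (metis subsetD)
    show "hd xs < c" if c: "c \<in> {1..n}" "p c = A - 1" for c
      using cases[OF c(1)] c left lastpos len by (auto simp: pF pR)
    show "c < last xs" if c: "c \<in> {1..n}" "p c = A + int (length xs)" for c
      using cases[OF c(1)]
    proof
      assume "c \<in> F" then show ?thesis using right c pF by simp
    next
      assume "\<exists>k<length R. c = R ! k"
      then obtain k where k: "k < length R" "c = R ! k" by blast
      then have "k = 0" using c lastpos pR[OF k(1)] by simp
      then show ?thesis using k hd_R lastF by simp
    qed
  qed
qed

lemma increasing_run_leader:
  assumes T: "trailing s S X"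
  shows "increasing_run n X R"
proof -
  obtain p where X: "located n X p" and pR: "\<And>k. k < length R \<Longrightarrow> p (R ! k) = S + int k"
    and pF: "\<And>x. x \<in> F \<Longrightarrow> p x = s x"
    using T unfolding trailing_def by blast
  have sS: "s x < S" if "x \<in> F" for x using T that unfolding trailing_def by blast
  have cases: "(x \<in> F \<or> (\<exists>k<length R. x = R ! k))" if "x \<in> {1..n}" for x
    using that balls by (metis Un_iff in_set_conv_nth)
  have ne: "R \<noteq> []" using length_R by auto
  show ?thesis
  proof (rule increasing_run_if_located[OF X ne sorted_R _ pR])
    show "set R \<subseteq> {1..n}" using balls by blast
    show "hd R < c" if c: "c \<in> {1..n}" "p c = S - 1" for c
      using cases[OF c(1)] c hd_R ne by (auto simp: pR hd_conv_nth)
    show "c < last R" if c: "c \<in> {1..n}" "p c = S + int (length R)" for c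
      using cases[OF c(1)] c sS[of c] by (auto simp: pF pR)
  qed
qed

text \<open>The right neighbour of a ball, if there is one, is smaller and has moved away when the ball jumps.
  So all balls of \<open>F\<close> move by one box, their relative positions persist, and each of them is a run
  of its own.\<close>

lemma steady_state_descending_clusters:
  assumes T: "trailing s S X" and inj: "inj_on s F"
    and desc: "\<And>x y. x \<in> F \<Longrightarrow> y \<in> F \<Longrightarrow> s y = s x + 1 \<Longrightarrow> y < x"
  shows "steady_state n X"
proof (rule steady_state_if_invariant)
  define I where "I = (\<lambda>Y. \<exists>d S. trailing (\<lambda>x. s x + d) S Y)"
  have "trailing (\<lambda>x. s x + 0) S X" using T by simp
  then show "I X" unfolding I_def by blast
  show "I (bb_move n Y)" if Y: "I Y" for Y
  proof -
    obtain d S where T: "trailing (\<lambda>x. s x + d) S Y" using Y unfolding I_def by blast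
    have "leap F (\<lambda>x. s x + d) (\<lambda>x. s x + (d + 1))"
      unfolding leap_def
    proof (intro ballI conjI impI allI)
      fix b c assume bc: "b \<in> F" "c \<in> F"
      show "s c + (d + 1) \<noteq> s b + (d + 1)" if "c < b"
        using inj_onD[OF inj _ bc(2,1)] that by auto
      show "s c + d \<noteq> s b + (d + 1)" if "b < c"
        using desc[OF bc] that by auto
    qed auto
    moreover have "s x + (d + 1) \<le> S" if "x \<in> F" for x
      using T that unfolding trailing_def by fastforce
    ultimately have "trailing (\<lambda>x. s x + (d + 1)) (S + int (length R)) (bb_move n Y)"
      by (intro trailing_bb_move[OF T]) force+
    then show ?thesis unfolding I_def by blast
  qed
  show "increasing_run n Y xs" if Y: "I Y" and xs: "xs \<in> insert R ((\<lambda>x. [x]) ` F)" for Y xs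
  proof -
    obtain d S where T: "trailing (\<lambda>x. s x + d) S Y" using Y unfolding I_def by blast
    from xs consider "xs = R" | x where "x \<in> F" "xs = [x]" by blast
    then show ?thesis
    proof cases
      case 1 then show ?thesis using increasing_run_leader[OF T] by simp
    next
      case 2
      then show ?thesis using desc
        by (intro increasing_run_trailing[OF T, where A = "s x + d"]) force+
    qed
  qed
  show "{1..n} \<subseteq> (\<Union>xs\<in>insert R ((\<lambda>x. [x]) ` F). set xs)" using balls by auto
qed

text \<open>The pair \<open>y1 y2\<close> moves two boxes at a time and \<open>z\<close>, somewhere behind it, moves one: if \<open>z\<close> is
  adjacent to the pair, \<open>y1 < z\<close> guarantees that the box in front of \<open>z\<close> has been vacated. In terms of
  tableaux, \<open>y1 y2\<close> is the first row and \<open>z\<close> the second.\<close>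

lemma steady_state_pair_ahead:
  assumes T: "trailing s S X" and F: "F = {z, y1, y2}" and ord: "y1 < z" "y1 < y2" "z \<noteq> y2"
    and snd_R: "R ! 1 < y2"
    and pos: "s z < s y1" "s y2 = s y1 + 1"
  shows "steady_state n X"
proof (rule steady_state_if_invariant)
  define I where "I = (\<lambda>Y. \<exists>s S. trailing s S Y \<and> s z < s y1 \<and> s y2 = s y1 + 1)"
  show "I X" using T pos unfolding I_def by blast
  show "I (bb_move n Y)" if Y: "I Y" for Y
  proof -
    obtain s S where T: "trailing s S Y" and pos: "s z < s y1" "s y2 = s y1 + 1"
      using Y unfolding I_def by blast
    define s' where "s' = (\<lambda>x. if x = z then s x + 1 else s x + 2)"
    have v: "s' z = s z + 1" "s' y1 = s y1 + 2" "s' y2 = s y1 + 3"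
      using ord pos by (auto simp: s'_def)
    have sS: "s z < S" "s y1 < S" "s y2 < S" using T F unfolding trailing_def by blast+
    have "leap {z, y1, y2} s s'"
      using ord pos v unfolding leap_def by simp
    then have "leap F s s'" by (simp only: F)
    then have "trailing s' (S + int (length R)) (bb_move n Y)"
      using sS pos snd_R by (intro trailing_bb_move[OF T]) (auto simp: F v)
    then show ?thesis unfolding I_def using v pos by force
  qed
  show "increasing_run n Y xs" if Y: "I Y" and xs: "xs \<in> {R, [z], [y1, y2]}" for Y xs
  proof -
    obtain s S where T: "trailing s S Y" and pos: "s z < s y1" "s y2 = s y1 + 1"
      using Y unfolding I_def by blast
    from xs consider "xs = R" | "xs = [z]" | "xs = [y1, y2]" by blast
    then show ?thesis
    proof cases
      case 1 then show ?thesis using increasing_run_leader[OF T] by simp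
    next
      case 2
      then show ?thesis using pos ord
        by (intro increasing_run_trailing[OF T, where A = "s z"]) (auto simp: F)
    next
      case 3
      then show ?thesis using pos ord
        by (intro increasing_run_trailing[OF T, where A = "s y1"]) (auto simp: F less_Suc_eq)
    qed
  qed
  show "{1..n} \<subseteq> (\<Union>xs\<in>{R, [z], [y1, y2]}. set xs)" using balls F by auto
qed

text \<open>While there is a gap in front of the adjacent ascent \<open>a b\<close>, the two balls move two boxes each and
  the single ball \<open>c\<close> moves one. In the tightest case \<open>b\<close> lands on the old box of \<open>c\<close>,
  which is free since \<open>c < b\<close>.\<close>

lemma leap_pair_behind:
  assumes "a < b" "c < b" "a \<noteq> c"
    and "s b = s a + 1" "s c = s a + 3 + int g"
    and "s' a = s a + 2" "s' b = s a + 3" "s' c = s a + 4 + int g"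
  shows "leap {a, b, c} s s'"
  using assms unfolding leap_def by simp

text \<open>The two disjuncts are the words with tableau \<open>y1 y2\<close> over \<open>z\<close> that begin with an ascent. Each
  move closes the gap of \<open>g\<close> boxes between \<open>b\<close> and \<open>c\<close> by one. Once the three balls are
  adjacent, one more move rearranges both words into \<open>z y1 y2\<close>, where the pair is ahead.\<close>

lemma steady_state_pair_behind:
  assumes F: "F = {a, b, c}" and ord: "y1 < z" "y1 < y2" "z \<noteq> y2"
    and word: "(a, b, c) = (y1, z, y2) \<and> y2 < z \<or> (a, b, c) = (z, y2, y1) \<and> z < y2"
    and snd_R: "R ! 1 < y2"
    and T: "trailing s S X" and pos: "s b = s a + 1" "s c = s b + 1 + int g"
  shows "steady_state n ((bb_move n ^^ Suc g) X)"
  using T pos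
proof (induction g arbitrary: s S X)
  case 0
  \<comment> \<open>\<open>z\<close>, one of the adjacent two, stays behind, and \<open>c\<close> takes its place in the pair\<close>
  define s' where "s' = (\<lambda>x. if x = z then s a + 2 else if x = y1 then s a + 3 else s a + 4)"
  have v: "s' z = s a + 2" "s' y1 = s a + 3" "s' y2 = s a + 4"
    using ord by (auto simp: s'_def)
  have F': "F = {z, y1, y2}" using F word by auto
  have "s c < S" using 0(1) F unfolding trailing_def by blast
  then have sS: "s a + 3 \<le> S" using 0(2,3) by simp
  have "leap {a, b, c} s s'"
    using word
  proof
    assume "(a, b, c) = (y1, z, y2) \<and> y2 < z"
    then show ?thesis using ord v 0(2,3) unfolding leap_def by simp presburger
  next
    assume "(a, b, c) = (z, y2, y1) \<and> z < y2"
    then show ?thesis using ord v 0(2,3) unfolding leap_def by simp presburger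
  qed
  then have "leap F s s'" by (simp only: F)
  then have "trailing s' (S + int (length R)) (bb_move n X)"
    using sS snd_R by (intro trailing_bb_move[OF 0(1)]) (auto simp: F' v)
  then show ?case
    using steady_state_pair_ahead[OF _ F' ord snd_R] v by simp
next
  case (Suc g)
  have abc: "a < b" "c < b" "a \<noteq> c" using word ord by auto
  define s' where "s' = (\<lambda>x. if x = c then s x + 1 else s x + 2)"
  have v: "s' a = s a + 2" "s' b = s a + 3" "s' c = s a + 4 + int g"
    using abc Suc.prems(2,3) by (simp_all add: s'_def)
  have "s c < S" using Suc.prems(1) F unfolding trailing_def by blast
  then have sS: "s a + 4 + int g \<le> S" using Suc.prems(2,3) by simp
  have "leap {a, b, c} s s'"
    by (rule leap_pair_behind[OF abc]) (use v Suc.prems(2,3) in simp_all)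
  then have "leap F s s'" by (simp only: F)
  then have "trailing s' (S + int (length R)) (bb_move n X)"
    using sS by (intro trailing_bb_move[OF Suc.prems(1)]) (auto simp: F v)
  from Suc.IH[OF this] show ?case using v by (simp add: funpow_swap1)
qed

end

section \<open>The first move is insertion into the first row\<close>

text \<open>The order in which entries stand in a sorted row is determined by their set, so insertion can be
  described by its effect on this set: \<open>x\<close> is added, in exchange for the least larger entry if there
  is one.\<close>

lemma row_insert_sorted:
  assumes "sorted_wrt (<) r" "x \<notin> set r" "row_insert x r = (r', b)"
  shows "sorted_wrt (<) r' \<and>
    (case b of None \<Rightarrow> (\<forall>y\<in>set r. y < x) \<and> set r' = insert x (set r)
     | Some y \<Rightarrow> y \<in> set r \<and> x < y \<and> (\<forall>z\<in>set r. z < y \<longrightarrow> z < x) \<and>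
         set r' = insert x (set r - {y}))"
  using assms
proof (induction r arbitrary: r')
  case Nil
  then show ?case by auto
next
  case (Cons a r)
  show ?case
  proof (cases "x < a")
    case True
    then show ?thesis using Cons.prems by force
  next
    case False
    then have ax: "a < x" using Cons.prems by auto
    obtain s where s: "row_insert x r = (s, b)" "r' = a # s"
      using False Cons.prems by (auto split: prod.splits)
    have "sorted_wrt (<) r" "x \<notin> set r" using Cons.prems by auto
    note IH = Cons.IH[OF this s(1)]
    show ?thesis
    proof (cases b)
      case None
      then show ?thesis using IH s ax Cons.prems by auto
    next
      case (Some y)
      then have "a < y" using IH Cons.prems by auto
      then show ?thesis using Some IH s ax Cons.prems by auto
    qed
  qed
qed

definition tableau :: "nat list \<Rightarrow> nat list list" where
  "tableau xs = foldl (\<lambda>P x. fst (tableau_insert x P)) [] xs"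

lemma insertion_tableau_eq_tableau: "insertion_tableau xs = tableau xs"
proof -
  have "fst (fold rs_step (List.enumerate k xs) (P, Q)) = foldl (\<lambda>P x. fst (tableau_insert x P)) P xs"
    for k P Q
    by (induction xs arbitrary: k P Q) (simp_all add: rs_step_def split_beta Let_def)
  then show ?thesis
    by (simp add: insertion_tableau_def robinson_schensted_def tableau_def)
qed

context
  fixes w :: "nat \<Rightarrow> nat"
begin

fun row :: "nat \<Rightarrow> nat list" where
  "row 0 = []"
| "row (Suc i) = fst (row_insert (w (Suc i)) (row i))"

fun bump :: "nat \<Rightarrow> nat option" where
  "bump 0 = None"
| "bump (Suc i) = snd (row_insert (w (Suc i)) (row i))"

text \<open>The bumped entries in the order in which they are bumped, that is, the word that is inserted
  into the rows below the first.\<close>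

definition bumped :: "nat \<Rightarrow> nat list" where
  "bumped i = map (the \<circ> bump) (filter (\<lambda>j. bump j \<noteq> None) [1..<Suc i])"

text \<open>Row insertion passes on only the bumped entry, so the tableau below the first row is the tableau
  of the bumped word.\<close>

lemma tableau_eq_row_Cons:
  "tableau (map w [1..<Suc i]) = (if i = 0 then [] else row i # tableau (bumped i))"
proof (induction i)
  case 0
  then show ?case by (simp add: tableau_def)
next
  case (Suc i)
  have "tableau (map w [1..<Suc (Suc i)]) =
      fst (tableau_insert (w (Suc i)) (tableau (map w [1..<Suc i])))"
    by (simp add: tableau_def)
  also have "\<dots> = fst (tableau_insert (w (Suc i)) (if i = 0 then [] else row i # tableau (bumped i)))"
    unfolding Suc ..
  also have "\<dots> = row (Suc i) # tableau (bumped (Suc i))"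
    by (auto simp: bumped_def tableau_def split: prod.splits option.splits)
  finally show ?case by simp
qed

lemma length_row_plus_length_bumped: "length (row i) + length (bumped i) = i"
proof (induction i)
  case 0
  show ?case by (simp add: bumped_def)
next
  case (Suc i)
  then show ?case
    using row_insert_length[of "w (Suc i)" "row i"] by (cases "bump (Suc i)") (auto simp: bumped_def)
qed

context
  fixes n :: nat
  assumes w: "w permutes {1..n}"
begin

lemma w_eq_iff: "w i = w j \<longleftrightarrow> i = j"
  using permutes_inj[OF w] by (rule inj_eq)

lemma row_invariant:
  "sorted_wrt (<) (row i) \<and> set (row i) \<subseteq> w ` {1..i}"
proof (induction i)
  case (Suc i)
  have "w (Suc i) \<notin> w ` {1..i}" by (auto simp: w_eq_iff)
  then have new: "w (Suc i) \<notin> set (row i)" using Suc by blast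
  obtain r b where rb: "row_insert (w (Suc i)) (row i) = (r, b)" by fastforce
  have "set r \<subseteq> insert (w (Suc i)) (set (row i))"
    using row_insert_sorted[OF _ new rb] Suc by (auto split: option.splits)
  moreover have "w ` {1..Suc i} = insert (w (Suc i)) (w ` {1..i})"
    by (simp add: atLeastAtMostSuc_conv)
  ultimately show ?case using row_insert_sorted[OF _ new rb] Suc rb by auto
qed simp

lemma new_entry: "i > 0 \<Longrightarrow> w i \<notin> set (row (i - 1))"
proof
  assume "i > 0" "w i \<in> set (row (i - 1))"
  then obtain j where "j \<in> {1..i - 1}" "w i = w j" using row_invariant by blast
  then show False using \<open>i > 0\<close> by (auto simp: w_eq_iff)
qed

lemma row_None:
  assumes "i > 0" "bump i = None"
  shows "set (row i) = insert (w i) (set (row (i - 1)))"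
    and "\<forall>y\<in>set (row (i - 1)). y < w i"
  using row_insert_sorted[OF _ new_entry[OF assms(1)], of "row i" None] row_invariant assms
  by (cases i; auto simp: prod_eq_iff)+

lemma row_Some:
  assumes "bump i = Some y"
  shows "i > 0" "y \<in> set (row (i - 1))" "w i < y" "\<forall>z\<in>set (row (i - 1)). z < y \<longrightarrow> z < w i"
    and "set (row i) = insert (w i) (set (row (i - 1)) - {y})"
proof -
  show i: "i > 0" using assms by (cases i) auto
  then have "row_insert (w i) (row (i - 1)) = (row i, Some y)"
    using assms by (cases i) (auto simp: prod_eq_iff)
  from row_insert_sorted[OF _ new_entry[OF i] this] row_invariant
  show "y \<in> set (row (i - 1))" "w i < y" "\<forall>z\<in>set (row (i - 1)). z < y \<longrightarrow> z < w i"
    "set (row i) = insert (w i) (set (row (i - 1)) - {y})" by auto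
qed

text \<open>An entry stays in the first row from its insertion until it is bumped, and it never comes back.\<close>

lemma in_row_iff:
  assumes "1 \<le> i"
  shows "w i \<in> set (row j) \<longleftrightarrow> i \<le> j \<and> (\<forall>k\<le>j. bump k \<noteq> Some (w i))"
proof (induction j)
  case (Suc j)
  have inj: "w i = w (Suc j) \<longleftrightarrow> i = Suc j" by (auto simp: w_eq_iff)
  have early: "bump k \<noteq> Some (w i)" if "k \<le> i" for k
  proof
    assume k: "bump k = Some (w i)"
    from row_Some(2)[OF k] obtain l where "l \<in> {1..k - 1}" "w i = w l" using row_invariant by blast
    then show False using row_Some(1)[OF k] that by (auto simp: w_eq_iff)
  qed
  show ?case
  proof (cases "i = Suc j")
    case True
    have "w (Suc j) \<in> set (row (Suc j))"
      using row_None(1)[of "Suc j"] row_Some(5)[of "Suc j"]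
      by (cases "bump (Suc j)") (auto simp del: row.simps bump.simps)
    then show ?thesis using True early by (auto simp del: row.simps bump.simps)
  next
    case False
    then have "w i \<in> set (row (Suc j)) \<longleftrightarrow> w i \<in> set (row j) \<and> bump (Suc j) \<noteq> Some (w i)"
      using row_None(1)[of "Suc j"] row_Some(5)[of "Suc j"] inj
      by (cases "bump (Suc j)") (auto simp del: row.simps bump.simps)
    then show ?thesis using Suc False by (auto simp del: row.simps bump.simps simp: le_Suc_eq)
  qed
qed (use assms in auto)

lemma bump_late:
  assumes "1 \<le> i" "bump k = Some (w i)"
  shows "i < k"
  using row_Some(1,2)[OF assms(2)] in_row_iff[OF assms(1)] by fastforce

lemma bump_inj:
  assumes "bump j = Some b" "bump k = Some b"
  shows "j = k"
proof -
  have "\<not> j < k" if jk: "bump j = Some b" "bump k = Some b" for j k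
  proof
    assume "j < k"
    obtain i where i: "1 \<le> i" "b = w i" using row_Some(2)[OF jk(1)] row_invariant by fastforce
    have "w i \<notin> set (row (k - 1))" using in_row_iff[OF i(1)] jk(1) i(2) \<open>j < k\<close> by fastforce
    then show False using row_Some(2)[OF jk(2)] i by simp
  qed
  from this[OF assms] this[OF assms(2,1)] show ?thesis by simp
qed

text \<open>An insertion that bumps an entry below \<open>v\<close> replaces it by a still smaller one.\<close>

lemma count_below_mono:
  assumes "i \<le> j"
  shows "card {u\<in>set (row i). u < v} \<le> card {u\<in>set (row j). u < v}"
  using assms
proof (induction j rule: dec_induct)
  case (step j)
  have "card {u\<in>set (row j). u < v} \<le> card {u\<in>set (row (Suc j)). u < v}"
  proof (cases "bump (Suc j)")
    case None
    from row_None(1)[OF _ this] show ?thesis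
      by (intro card_mono) (auto simp del: row.simps bump.simps)
  next
    case (Some y)
    note Y = row_Some[OF this, simplified diff_Suc_1]
    show ?thesis
    proof (cases "y < v")
      case True
      have "w (Suc j) \<notin> set (row j)" using new_entry[of "Suc j"] by simp
      then have "{u\<in>set (row (Suc j)). u < v} = insert (w (Suc j)) ({u\<in>set (row j). u < v} - {y})"
        using Y(3,5) True by (auto simp del: row.simps bump.simps)
      also have "card \<dots> = Suc (card ({u\<in>set (row j). u < v} - {y}))"
        using \<open>w (Suc j) \<notin> set (row j)\<close> by (subst card_insert_disjoint) auto
      also have "\<dots> = card {u\<in>set (row j). u < v}"
        using Y(2) True by (intro card.remove[symmetric]) auto
      finally show ?thesis by simp
    next
      case False
      then show ?thesis using Y(5)
        by (intro card_mono) (auto simp del: row.simps bump.simps)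
    qed
  qed
  with step show ?case by simp
qed simp

lemma nth_row_less:
  assumes "k < card {u\<in>set (row i). u < v}"
  shows "k < length (row i)" "row i ! k < v"
proof -
  have srt: "sorted_wrt (<) (row i)" using row_invariant by blast
  have "card {u\<in>set (row i). u < v} \<le> card (set (row i))" by (rule card_mono) auto
  also have "\<dots> \<le> length (row i)" by (rule card_length)
  finally show k: "k < length (row i)" using assms by simp
  show "row i ! k < v"
  proof (rule ccontr)
    assume not: "\<not> row i ! k < v"
    have "{u\<in>set (row i). u < v} \<subseteq> (\<lambda>l. row i ! l) ` {..<k}"
    proof
      fix u assume "u \<in> {u\<in>set (row i). u < v}"
      then obtain l where l: "l < length (row i)" "u = row i ! l" "u < v"
        by (auto simp: in_set_conv_nth)
      have "\<not> k \<le> l" using sorted_wrt_nth_less[OF srt, of k l] l not by (cases "k = l") auto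
      then show "u \<in> (\<lambda>l. row i ! l) ` {..<k}" using l by auto
    qed
    then have "card {u\<in>set (row i). u < v} \<le> card ((\<lambda>l. row i ! l) ` {..<k})" 
      by (intro card_mono) auto
    also have "\<dots> \<le> k" using card_image_le[of "{..<k}"] by simp
    finally show False using assms by simp
  qed
qed

text \<open>Together with the next lemma, this compares the first row with the entries bumped from it. The
  entry that bumps \<open>v\<close> lies below \<open>v\<close>, and the number of row entries below \<open>v\<close> never drops.\<close>

lemma bumped_below_row_0:
  assumes v: "bump j = Some v" and jn: "j \<le> i"
  shows "row i ! 0 < v"
proof -
  have "w j \<in> {u\<in>set (row j). u < v}" using row_Some[OF v] by auto
  then have "0 < card {u\<in>set (row j). u < v}" by (auto simp: card_gt_0_iff)
  then show ?thesis using nth_row_less(2) count_below_mono[OF jn, of v] by (meson order.strict_trans2)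
qed

text \<open>The entry that bumps \<open>u\<close> already lies below \<open>v\<close>, and the one that bumps \<open>v\<close> adds a second entry
  below \<open>v\<close>.\<close>

lemma ascending_bumps_below_row_1:
  assumes u: "bump i = Some u" and v: "bump j = Some v" and ij: "i < j" "u < v" and jn: "j \<le> m"
  shows "1 < length (row m)" "row m ! 1 < v"
proof -
  have "w i \<in> {u\<in>set (row i). u < v}" using row_Some[OF u] ij by auto
  then have "1 \<le> card {u\<in>set (row i). u < v}" by (simp add: Suc_le_eq card_gt_0_iff) blast
  also have "\<dots> \<le> card {u\<in>set (row (j - 1)). u < v}" using ij by (intro count_below_mono) simp
  finally have "2 \<le> Suc (card {u\<in>set (row (j - 1)). u < v})" by simp
  also have "\<dots> = card (insert (w j) {u\<in>set (row (j - 1)). u < v})"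
    using new_entry[OF row_Some(1)[OF v]] by (subst card_insert_disjoint) auto
  also have "insert (w j) {u\<in>set (row (j - 1)). u < v} = {u\<in>set (row j). u < v}"
    using row_Some(3,5)[OF v] by auto
  also have "card \<dots> \<le> card {u\<in>set (row m). u < v}" by (rule count_below_mono[OF jn])
  finally have "1 < card {u\<in>set (row m). u < v}" by simp
  from nth_row_less[OF this] show "1 < length (row m)" "row m ! 1 < v" by auto
qed

text \<open>The entry \<open>w i\<close> that bumps \<open>u\<close> is smaller than \<open>u\<close>, so it is not \<open>v\<close>. Hence \<open>u\<close> and \<open>v\<close> both
  come from the first \<open>i - 1\<close> insertions.\<close>

lemma consecutive_ascending_bumps_late:
  assumes u: "bump i = Some u" and v: "bump (Suc i) = Some v" and "u < v"
  shows "3 \<le> i"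
proof -
  have "v \<noteq> w i" using row_Some(3)[OF u] \<open>u < v\<close> by auto
  then have "v \<in> set (row (i - 1))" using row_Some(2)[OF v] row_Some(5)[OF u] by simp
  moreover have "u \<in> set (row (i - 1))" by (rule row_Some(2)[OF u])
  ultimately have "card {u, v} \<le> card (set (row (i - 1)))" by (intro card_mono) auto
  also have "\<dots> \<le> length (row (i - 1))" by (rule card_length)
  also have "\<dots> \<le> i - 1" using length_row_plus_length_bumped[of "i - 1"] by linarith
  finally show ?thesis using \<open>u < v\<close> by simp
qed

text \<open>Ball \<open>b\<close> is in flight over exactly those boxes at which it belongs to the first row. Suppose it
  passes a box of the word, say the one of \<open>w l\<close>. If \<open>w l\<close> is larger than \<open>b\<close>, that ball has not
  moved yet. If it is smaller, its insertion bumps an entry below \<open>b\<close>, which has already landed in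
  this box. Beyond the word the balls of the final row land in increasing order.\<close>

lemma first_move:
  obtains q where "located n (bb_move n (perm_config n w)) q"
    and "\<And>k. k < length (row n) \<Longrightarrow> q (row n ! k) = int n + 1 + int k"
    and "\<And>j b. j \<le> n \<Longrightarrow> bump j = Some b \<Longrightarrow> q b = int j"
proof -
  define p where "p = (\<lambda>b. int (inv w b))"
  define q where "q = (\<lambda>b. if \<exists>j\<le>n. bump j = Some b then int (THE j. bump j = Some b)
      else int n + 1 + int (THE k. k < length (row n) \<and> row n ! k = b))"
  have srt: "sorted_wrt (<) (row n)" using row_invariant by blast
  have qb: "q b = int j" if "j \<le> n" "bump j = Some b" for j b
  proof -
    have "(THE j. bump j = Some b) = j" using that bump_inj by (intro the_equality) auto
    then show ?thesis using that by (auto simp: q_def)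
  qed
  have qr: "q (row n ! k) = int n + 1 + int k" if k: "k < length (row n)" for k
  proof -
    have "row n ! k \<in> set (row n)" using k by simp
    then obtain i where i: "1 \<le> i" "row n ! k = w i" using row_invariant by fastforce
    then have nb: "\<not> (\<exists>j\<le>n. bump j = Some (row n ! k))" using in_row_iff[OF i(1), of n] k
      by (metis nth_mem)
    have "(THE l. l < length (row n) \<and> row n ! l = row n ! k) = k"
    proof (rule the_equality)
      show "l = k" if "l < length (row n) \<and> row n ! l = row n ! k" for l
        using that k sorted_wrt_nth_less[OF srt, of l k] sorted_wrt_nth_less[OF srt, of k l]
        by (cases l k rule: linorder_cases) auto
    qed (use k in simp)
    then show ?thesis unfolding q_def if_not_P[OF nb] by simp
  qed
  have pw: "p (w i) = int i" for i using permutes_inj[OF w] by (simp add: p_def)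
  have ball: "\<exists>i\<in>{1..n}. b = w i" if "b \<in> {1..n}" for b
    using that permutes_image[OF w] by (metis imageE)
  have wn: "w i \<in> {1..n} \<longleftrightarrow> i \<in> {1..n}" for i using permutes_in_image[OF w] by simp
  have X: "located n (perm_config n w) p"
    unfolding located_def
  proof (intro conjI ballI allI)
    fix b k assume b: "b \<in> {1..n}"
    then obtain i where i: "i \<in> {1..n}" "b = w i" using ball by blast
    show "perm_config n w k = b \<longleftrightarrow> k = p b"
      using i b pw[of i] by (auto simp: perm_config_def w_eq_iff)
  next
    fix k :: int
    show "perm_config n w k \<notin> {1..n} \<longrightarrow> perm_config n w k = n + 1"
      using wn[of "nat k"] by (auto simp: perm_config_def)
  qed
  have leave: "(\<exists>j\<le>n. bump j = Some (w i) \<and> q (w i) = int j) \<or>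
      (\<exists>k<length (row n). w i = row n ! k \<and> q (w i) = int n + 1 + int k)" if "i \<in> {1..n}" for i
  proof (cases "\<exists>j\<le>n. bump j = Some (w i)")
    case True then show ?thesis using qb by blast
  next
    case False
    then have "w i \<in> set (row n)" using in_row_iff[of i n] that by auto
    then show ?thesis using qr by (metis in_set_conv_nth)
  qed
  have "leap {1..n} p q"
    unfolding leap_def
  proof (intro ballI)
    fix b assume b: "b \<in> {1..n}"
    then obtain i where i: "i \<in> {1..n}" "b = w i" using ball by blast
    have qinj: "c = b" if c: "c \<in> {1..n}" "q c = q b" for c
    proof -
      obtain l where l: "l \<in> {1..n}" "c = w l" using ball c by blast
      from leave[OF l(1)] leave[OF i(1)] show ?thesis
        using c l i by auto
    qed
    have "p b < q b"
      using leave[OF i(1)] bump_late[of i] i pw[of i] by auto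
    moreover have "p c \<noteq> q b" if c: "c \<in> {1..n}" "b < c" for c
    proof
      assume e: "p c = q b"
      obtain l where l: "l \<in> {1..n}" "c = w l" using ball c by blast
      then have "bump l = Some b" using leave[OF i(1)] e pw[of l] i by auto
      then show False using row_Some(3) l c by fastforce
    qed
    moreover have "(\<exists>c\<in>{1..n}. c < b \<and> q c = j) \<or> (\<exists>c\<in>{1..n}. b < c \<and> p c = j)"
      if j: "p b < j \<and> j < q b" for j
    proof (cases "j \<le> int n")
      case True
      define l where "l = nat j"
      have l: "j = int l" "i < l" "l \<le> n" using True j i pw[of i] by (auto simp: l_def)
      have c: "w l \<in> {1..n}" "w l \<noteq> b" using wn[of l] l i by (auto simp: w_eq_iff)
      show ?thesis
      proof (cases "b < w l")
        case True
        then show ?thesis using c pw[of l] l by blast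
      next
        case False
        then have less: "w l < b" using c by simp
        have nb: "bump k \<noteq> Some b" if "k \<le> l" for k
          using qb[of k b] that l j by auto
        then have inrow: "b \<in> set (row (l - 1))" using in_row_iff[of i "l - 1"] i l by auto
        then obtain d where d: "bump l = Some d"
          using row_None(2)[of l] less l by (cases "bump l") auto
        have "d < b" using row_Some(4)[OF d] inrow less nb[of l] d by (metis less_irrefl
            linorder_neqE_nat not_less_iff_gr_or_eq order_refl)
        moreover have "d \<in> {1..n}"
        proof -
          obtain k where "k \<in> {1..l - 1}" "d = w k" using row_Some(2)[OF d] row_invariant by blast
          then show ?thesis using wn[of k] l by auto
        qed
        ultimately show ?thesis using qb[OF l(3) d] l by blast
      qed
    next
      case False
      then obtain k where k: "k < length (row n)" "b = row n ! k" "q b = int n + 1 + int k"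
        using leave[OF i(1)] j i by auto
      define l where "l = nat (j - int n - 1)"
      have l: "l < k" "j = int n + 1 + int l" using False j k by (auto simp: l_def)
      have "row n ! l < b" using sorted_wrt_nth_less[OF srt, of l k] l k by simp
      moreover have "row n ! l \<in> {1..n}"
      proof -
        have "row n ! l \<in> set (row n)" using l k by simp
        then obtain i where "i \<in> {1..n}" "row n ! l = w i" using row_invariant by blast
        then show ?thesis using wn[of i] by simp
      qed
      ultimately show ?thesis using qr[of l] l k by force
    qed
    ultimately show "p b < q b \<and>
        (\<forall>c\<in>{1..n}. c < b \<longrightarrow> q c \<noteq> q b) \<and> (\<forall>c\<in>{1..n}. b < c \<longrightarrow> p c \<noteq> q b) \<and>
        (\<forall>i. p b < i \<and> i < q b \<longrightarrow>
           (\<exists>c\<in>{1..n}. c < b \<and> q c = i) \<or> (\<exists>c\<in>{1..n}. b < c \<and> p c = i))"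
      using qinj by blast
  qed
  from that[OF located_bb_move[OF X this] qr qb] show thesis .
qed

end

end

section \<open>The bound\<close>

text \<open>Inserting an increasing word yields a single row, and inserting a decreasing one a single column.\<close>

lemma shape_tableau_2_1:
  assumes "shape (tableau [a, b, c]) = [2, 1]"
  shows "\<not> (a \<le> b \<and> b \<le> c)" "\<not> (c < b \<and> b < a)"
  using assms by (auto simp: tableau_def shape_def split: if_splits)

lemma steady_state_time_le:
  assumes "steady_state n ((bb_move n ^^ t) (perm_config n w))" "t \<le> m"
  shows "steady_state_time n w \<le> enat m"
  unfolding steady_state_time_def
  by (rule INF_lower2[of t]) (use assms in auto)

theorem theorem4:
  fixes n :: nat and w :: "nat \<Rightarrow> nat"
  assumes "w permutes {1..n}"
    and "rs_partition n w = [n - 3, 2, 1]"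
  shows "steady_state_time n w \<le> enat (n - 3)"
proof -
  note w = assms(1)
  define R where "R = row w n"
  define X where "X = bb_move n (perm_config n w)"
  have "shape (tableau (map w [1..<Suc n])) = [n - 3, 2, 1]"
    using assms(2) by (simp add: rs_partition_def one_line_def insertion_tableau_eq_tableau)
  then have n: "n \<noteq> 0" and lenR: "length R = n - 3" and sh: "shape (tableau (bumped w n)) = [2, 1]"
    unfolding tableau_eq_row_Cons by (auto simp: shape_def R_def split: if_splits)
  have lens: "length R + length (bumped w n) = n"
    unfolding R_def by (rule length_row_plus_length_bumped)
  \<comment> \<open>the first row is not empty, which excludes the sizes for which \<open>n - 3\<close> is cut off at zero\<close>
  have "w n \<in> set R"
    using in_row_iff[OF w, of n n] bump_late[OF w, of n] n unfolding R_def by fastforce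
  then have "R \<noteq> []" by auto
  then have len3: "length (bumped w n) = 3" using lens lenR by (cases R) auto
  define J where "J = filter (\<lambda>j. bump w j \<noteq> None) [1..<Suc n]"
  have bJ: "bumped w n = map (the \<circ> bump w) J" by (simp add: J_def bumped_def)
  then obtain \<alpha> \<beta> \<gamma> where J: "J = [\<alpha>, \<beta>, \<gamma>]" using len3
    by (auto simp: numeral_3_eq_3 length_Suc_conv)
  have "sorted_wrt (<) J" unfolding J_def by (intro sorted_wrt_filter sorted_wrt_upt)
  then have ord: "\<alpha> < \<beta>" "\<beta> < \<gamma>" using J by auto
  have setJ: "j \<in> {\<alpha>, \<beta>, \<gamma>} \<longleftrightarrow> 1 \<le> j \<and> j \<le> n \<and> bump w j \<noteq> None" for j
  proof -
    have "j \<in> set J \<longleftrightarrow> 1 \<le> j \<and> j \<le> n \<and> bump w j \<noteq> None" unfolding J_def by auto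
    then show ?thesis using J by simp
  qed
  obtain a b c where abc: "bump w \<alpha> = Some a" "bump w \<beta> = Some b" "bump w \<gamma> = Some c"
    using setJ[of \<alpha>] setJ[of \<beta>] setJ[of \<gamma>] by auto
  have \<gamma>: "\<gamma> \<le> n" using setJ[of \<gamma>] by blast
  have bumped: "bumped w n = [a, b, c]" unfolding bJ J using abc by simp
  note word = shape_tableau_2_1[OF sh[unfolded bumped]]
  have dist: "a \<noteq> b" "b \<noteq> c" "a \<noteq> c"
    using bump_inj[OF w, of \<alpha> a \<beta>] bump_inj[OF w, of \<beta> b \<gamma>] bump_inj[OF w, of \<alpha> a \<gamma>] abc ord
    by auto
  define F where "F = {a, b, c}"
  have le_n: "\<alpha> \<le> n" "\<beta> \<le> n" using ord \<gamma> by auto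
  have bumps: "x \<in> F" if x: "bump w j = Some x" "j \<le> n" for j x
  proof -
    have "j \<in> {\<alpha>, \<beta>, \<gamma>}" using setJ[of j] row_Some(1)[OF w x(1)] x by simp
    then show ?thesis using abc x unfolding F_def by auto
  qed
  have inF: "\<exists>j\<le>n. bump w j = Some x" if "x \<in> F" for x
    using that abc le_n \<gamma> unfolding F_def by blast
  have row1: "2 \<le> length R \<and> R ! 1 < v"
    if "bump w i = Some u" "bump w j = Some v" "i < j" "u < v" "j \<le> n" for i j u v
    using ascending_bumps_below_row_1[OF w that] unfolding R_def by simp
  have R_or_F: "w i \<in> set R \<longleftrightarrow> w i \<notin> F" if "i \<in> {1..n}" for i
  proof -
    have "1 \<le> i" "i \<le> n" using that by auto
    with in_row_iff[OF w, of i n] show ?thesis using bumps inF unfolding R_def by blast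
  qed
  have Rw: "set R \<subseteq> w ` {1..n}" using row_invariant[OF w] unfolding R_def by blast
  have Fw: "F \<subseteq> w ` {1..n}"
  proof
    fix x assume "x \<in> F"
    then obtain j where j: "j \<le> n" "bump w j = Some x" using inF by blast
    from row_Some(2)[OF w j(2)] have "x \<in> w ` {1..j - 1}" using row_invariant[OF w] by blast
    moreover have "w ` {1..j - 1} \<subseteq> w ` {1..n}" using j(1) by (intro image_mono) auto
    ultimately show "x \<in> w ` {1..n}" by blast
  qed
  have img: "w ` {1..n} = {1..n}" by (rule permutes_image[OF w])
  have R_eq: "set R = {1..n} - F"
  proof (rule set_eqI)
    fix x
    show "x \<in> set R \<longleftrightarrow> x \<in> {1..n} - F"
    proof (cases "x \<in> w ` {1..n}")
      case True
      then obtain i where i: "i \<in> {1..n}" "x = w i" by blast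
      have "x \<in> {1..n}" using True unfolding img .
      then show ?thesis using R_or_F[OF i(1)] i(2) by simp
    next
      case False
      then show ?thesis using Rw unfolding img by blast
    qed
  qed
  interpret leading_run n R F
  proof
    show "sorted_wrt (<) R" using row_invariant[OF w] unfolding R_def by blast
    show "set R \<inter> F = {}" using R_eq by blast
    show "set R \<union> F = {1..n}" using R_eq Fw unfolding img by blast
    show "R ! 0 < x" if x: "x \<in> F" for x
    proof -
      obtain j where "j \<le> n" "bump w j = Some x" using inF[OF x] by blast
      then show ?thesis using bumped_below_row_0[OF w, of j x n] unfolding R_def by simp
    qed
    show "2 \<le> length R"
    proof (cases "a < b")
      case True
      then show ?thesis using row1[OF abc(1,2)] ord le_n by simp
    next
      case False
      then have "b < c" using word dist by linarith
      then show ?thesis using row1[OF abc(2,3)] ord \<gamma> by simp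
    qed
  qed
  obtain s where s: "located n X s" "\<And>k. k < length R \<Longrightarrow> s (R ! k) = int n + 1 + int k"
    "\<And>j b. j \<le> n \<Longrightarrow> bump w j = Some b \<Longrightarrow> s b = int j"
    using first_move[OF w] unfolding X_def R_def by blast
  have sF: "s a = int \<alpha>" "s b = int \<beta>" "s c = int \<gamma>" using s(3) abc ord \<gamma> by auto
  have T: "trailing s (int n + 1) X"
    unfolding trailing_def using s sF ord \<gamma> unfolding F_def by auto
  have inj: "inj_on s F" using sF ord unfolding F_def by (auto simp: inj_on_def)
  have later: "steady_state_time n w \<le> enat (n - 3)"
    if "steady_state n ((bb_move n ^^ t) X)" "Suc t \<le> n - 3" for t
    using steady_state_time_le[of n "Suc t" w "n - 3"] that unfolding X_def by (simp add: funpow_swap1)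
  have now: "steady_state_time n w \<le> enat (n - 3)" if "steady_state n X"
    using later[of 0] that length_R lenR by simp
  consider "b < a" "b < c" "\<gamma> = Suc \<beta>" | "b < a" "b < c" "\<gamma> \<noteq> Suc \<beta>"
    | "a < b" "c < b" "\<beta> \<noteq> Suc \<alpha>" | "a < b" "c < b" "\<beta> = Suc \<alpha>"
    using word dist by linarith
  then show ?thesis
  proof cases
    case 1
    have "steady_state n X"
      using 1 dist sF ord row1[OF abc(2,3)] \<gamma>
      by (intro steady_state_pair_ahead[OF T F_def]) auto
    then show ?thesis by (rule now)
  next
    case 2
    have "steady_state n X"
      using 2 sF ord by (intro steady_state_descending_clusters[OF T inj]) (auto simp: F_def)
    then show ?thesis by (rule now)
  next
    case 3
    have "steady_state n X"
      using 3 sF ord by (intro steady_state_descending_clusters[OF T inj]) (auto simp: F_def)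
    then show ?thesis by (rule now)
  next
    case 4
    \<comment> \<open>the number of boxes strictly between the second and the third straggler\<close>
    define g where "g = \<gamma> - \<beta> - 1"
    have pos: "s b = s a + 1" "s c = s b + 1 + int g" using sF ord 4 by (auto simp: g_def)
    have "3 \<le> \<alpha>" using consecutive_ascending_bumps_late[OF w abc(1)] abc(2) 4 by simp
    then have time: "Suc (Suc g) \<le> n - 3" using ord \<gamma> 4 unfolding g_def by linarith
    have "steady_state n ((bb_move n ^^ Suc g) X)"
    proof (cases "a < c")
      case True
      then show ?thesis using 4 ord row1[OF abc(1,3)] \<gamma>
        by (intro steady_state_pair_behind[OF F_def _ _ _ _ _ T pos, where ?y1.0 = a and z = b and ?y2.0 = c]) auto
    next
      case False
      then show ?thesis using 4 dist ord row1[OF abc(1,2)] \<gamma>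
        by (intro steady_state_pair_behind[OF F_def _ _ _ _ _ T pos, where ?y1.0 = c and z = a and ?y2.0 = b]) auto
    qed
    then show ?thesis using later time by blast
  qed
qed

end
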